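(* Let $A\in\mathbb R^{m\times n}$, $b\in\mathbb R^m$, $\beta\ge 0$, and let $f\in\mathcal S^{1,1}_{\mu,L}$ with $0\le\mu\le L<\infty$. Let $(x^*,\lambda^* )\in\mathbb R^n\times\mathbb R^m$ be a saddle point of $\mathcal L(x,\lambda)=f(x)+\langle\lambda,Ax-b\rangle$ (so $Ax^*=b$ and $\nabla f(x^* )+A^\top\lambda^*=0$). Let $\theta_0,\gamma_0>0$ and let $\theta,\gamma:[0,\infty)\to\mathbb R$ solve $\theta'=-\theta$, $\gamma'=\mu_\beta-\gamma$, $\theta(0)=\theta_0$, $\gamma(0)=\gamma_0$. Let $(\lambda,x,v)$ be the unique solution on $[0,\infty)$ of $$\theta\lambda'=Av-b,\qquad x'=v-x,\qquad \gamma v'=\mu_\beta(x-v)-\nabla_x\mathcal L_\beta(x,\lambda),$$ with initial condition $(\lambda(0),x(0),v(0))=(\lambda_0,x_0,v_0)\in\mathbb R^m\times\mathbb R^n\times\mathbb R^n$. Define $$\mathcal E(t)=\mathcal L_\beta(x(t),\lambda^* )-\mathcal L_\beta(x^*,\lambda(t))+\frac{\gamma(t)}2\|v(t)-x^*\|^2+\frac{\theta(t)}2\|\lambda(t)-\lambda^*\|^2,\quad t\ge0 .$$ Then for all $t\ge 0$ $$\frac{\mathrm d}{\mathrm dt}\mathcal E(t)\le-\mathcal E(t)-\frac{\mu_\beta}2\|x'(t)\|^2,$$ and $$\mathcal E(t)+\frac{\mu_\beta}2\int_0^te^{s-t}\|x'(s)\|^2\,\mathrm ds\le e^{-t}\mathcal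 E(0).$$ Moreover, with $\mathcal R_0=\sqrt{2\theta_0\mathcal E(0)}+\theta_0\|\lambda_0-\lambda^*\|+\|Ax_0-b\|$, for all $t\ge0$, $$\|Ax(t)-b\|\le e^{-t}\mathcal R_0,\qquad |f(x(t))-f(x^* )|\le e^{-t}\big(\mathcal E(0)+\mathcal R_0\|\lambda^*\|\big).$$
   Context: $\langle\cdot,\cdot\rangle$ is the Euclidean inner product and $\|\cdot\|$ the Euclidean norm. The class $\mathcal S^{1,1}_{\mu,L}$ ($\mu\ge0$) consists of the continuously differentiable convex functions $f:\mathbb R^n\to\mathbb R$ such that for all $x,y\in\mathbb R^n$: $f(y)\ge f(x)+\langle\nabla f(x),y-x\rangle+\frac\mu2\|y-x\|^2$ and $\langle\nabla f(x)-\nabla f(y),x-y\rangle\le L\|x-y\|^2$. Notation: $f_\beta(x)=f(x)+\frac\beta2\|Ax-b\|^2$; $\mathcal L_\beta(x,\lambda)=f_\beta(x)+\langle\lambda,Ax-b\rangle$, so $\nabla_x\mathcal L_\beta(x,\lambda)=\nabla f_\beta(x)+A^\top\lambda$. $\mu_\beta=\mu+\beta\sigma_{\min}^2(A)$, where $\sigma_{\min}(A)\ge0$ is the smallest singular value of $A$, i.e. $\sigma_{\min}^2(A)$ is the smallest eigenvalue of $A^\top A$ (so $\sigma_{\min}(A)>0$ means full column rank). A saddle point $(x^*,\lambda^* )$ of $\mathcal L$ satisfies $\mathcal L(x^*,\lambda)\le\mathcal L(x^*,\lambda^* )\le\mathcal L(x,\lambda^* )$ for all $x,\lambda$. *)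

theory Defs
  imports "HOL-Analysis.Analysis"
begin

text \<open>The description is only meaningful where \<open>f\<close> is differentiable;
  there the gradient exists and is unique.\<close>

definition grad :: "('a::euclidean_space \<Rightarrow> real) \<Rightarrow> 'a \<Rightarrow> 'a" where
  "grad f x = (THE D. GDERIV f x :> D)"

lemma gderiv_grad:
  fixes f :: "'a::euclidean_space \<Rightarrow> real"
  assumes "f differentiable (at x)"
  shows "GDERIV f x :> grad f x"
proof -
  obtain g where g: "(f has_derivative g) (at x)"
    using assms by (auto simp: differentiable_def)
  then have lin: "linear g" by (rule has_derivative_linear)
  have "g h = h \<bullet> adjoint g 1" for h
    using adjoint_works[OF lin, of h 1] by simp
  then have "g = (\<lambda>h. h \<bullet> adjoint g 1)" by blast
  then have D: "GDERIV f x :> adjoint g 1"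
    using g unfolding gderiv_def by simp
  moreover have "D' = adjoint g 1" if "GDERIV f x :> D'" for D'
  proof -
    have "(\<lambda>h. h \<bullet> D') = (\<lambda>h. h \<bullet> adjoint g 1)"
      using that D unfolding gderiv_def by (rule has_derivative_unique)
    then show ?thesis by (metis vector_eq_ldot)
  qed
  ultimately show ?thesis
    unfolding grad_def by (rule theI)
qed

definition class_S11 ::
  "real \<Rightarrow> real \<Rightarrow> ('a::euclidean_space \<Rightarrow> real) \<Rightarrow> bool" where
  "class_S11 \<mu> L f \<longleftrightarrow>
     (\<forall>x. f differentiable (at x)) \<and> continuous_on UNIV (grad f) \<and>
     convex_on UNIV f \<and>
     (\<forall>x y. f y \<ge> f x + grad f x \<bullet> (y - x) + \<mu> / 2 * (norm (y - x))\<^sup>2) \<and>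
     (\<forall>x y. (grad f x - grad f y) \<bullet> (x - y) \<le> L * (norm (x - y))\<^sup>2)"

definition eigenvalues :: "real^'n^'n \<Rightarrow> real set" where
  "eigenvalues M = {e. \<exists>u. u \<noteq> 0 \<and> M *v u = e *\<^sub>R u}"

text \<open>Singular values are indexed by the columns: they come from the Gram matrix of
  order \<open>CARD('n)\<close>, so \<open>0\<close> is one of them whenever \<open>A\<close> does not have full column rank
  (in particular if \<open>A\<close> has fewer rows than columns).\<close>

definition singular_values :: "real^'n^'m \<Rightarrow> real set" where
  "singular_values A = sqrt ` eigenvalues (transpose A ** A)"

definition sigma_min :: "real^'n^'m \<Rightarrow> real" where
  "sigma_min A = (LEAST s. s \<in> singular_values A)"

definition mu_aug :: "real^'n^'m \<Rightarrow> real \<Rightarrow> real \<Rightarrow> real" where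
  "mu_aug A \<beta> \<mu> = \<mu> + \<beta> * (sigma_min A)\<^sup>2"

definition lagr ::
  "(real^'n \<Rightarrow> real) \<Rightarrow> real^'n^'m \<Rightarrow> real^'m \<Rightarrow> real^'n \<Rightarrow> real^'m \<Rightarrow> real" where
  "lagr f A b x lam = f x + lam \<bullet> (A *v x - b)"

definition aug_obj ::
  "(real^'n \<Rightarrow> real) \<Rightarrow> real^'n^'m \<Rightarrow> real^'m \<Rightarrow> real \<Rightarrow> real^'n \<Rightarrow> real" where
  "aug_obj f A b \<beta> x = f x + \<beta> / 2 * (norm (A *v x - b))\<^sup>2"

definition aug_lagr ::
  "(real^'n \<Rightarrow> real) \<Rightarrow> real^'n^'m \<Rightarrow> real^'m \<Rightarrow> real \<Rightarrow> real^'n \<Rightarrow> real^'m \<Rightarrow> real" where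
  "aug_lagr f A b \<beta> x lam = aug_obj f A b \<beta> x + lam \<bullet> (A *v x - b)"

definition saddle_point :: "('a \<Rightarrow> 'b \<Rightarrow> real) \<Rightarrow> 'a \<Rightarrow> 'b \<Rightarrow> bool" where
  "saddle_point K xs ls \<longleftrightarrow> (\<forall>x l. K xs l \<le> K xs ls \<and> K xs ls \<le> K x ls)"

end

theory Submission
  imports Defs
begin

text \<open>
  The energy \<open>E\<close> is a Lyapunov function, and the flow is built so that the cross terms in its
  derivative cancel. Along a trajectory the gap \<open>aug_lagr (x t) ls - aug_lagr xs (lam t)\<close> has
  the constant subtrahend \<open>f xs\<close>, because the saddle point is feasible. Differentiating and
  substituting the three equations, the contribution of \<open>\<theta> lam' = A v - b\<close> turns
  the gradient at the multiplier \<open>lam t\<close>, which drives \<open>v\<close>, into the gradient at the fixed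
  multiplier \<open>ls\<close>; then \<open>x' = v - x\<close> lets the directions \<open>v - x\<close> and \<open>xs - v\<close>
  add up to \<open>xs - x\<close>. What is left is the linear part of the
  strong convexity inequality for \<open>aug_lagr _ ls\<close> between \<open>x t\<close> and \<open>xs\<close>, while the
  law for \<open>\<gamma>\<close> and the damping term \<open>mu_aug (x - v)\<close> together supply its quadratic part and the
  surplus \<open>- mu_aug / 2 * (norm x')\<^sup>2\<close> (\<open>flow_dissipation\<close>). The modulus \<open>mu_aug\<close> of this
  strong convexity (\<open>aug_lagr_strong_convexity\<close>) comes from \<open>norm (A u) \<ge> sigma_min A * norm u\<close>,
  that is, from the variational description of the smallest singular value
  (\<open>sigma_min_square_le\<close>).

  The integrated estimate is a Gronwall argument with the factor \<open>exp t\<close>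
  (\<open>gronwall_dissipation\<close>). It bounds \<open>E\<close> by \<open>exp (-t) * E 0\<close>, while \<open>\<theta>\<close> decays at the same rate;
  so \<open>norm (lam t - ls)\<close> stays bounded. The infeasibility is controlled by a conservation law:
  \<open>exp t (A x - b) - \<theta>0 lam\<close> is constant along the flow, so
  \<open>exp t * norm (A x - b)\<close> is bounded by the variation of the bounded multiplier.
  Finally the Lagrangian gap \<open>f x + ls \<bullet> (A x - b) - f xs\<close> lies between \<open>0\<close> and \<open>E\<close>, and the
  infeasibility estimate removes the middle term.
\<close>

section \<open>The smallest singular value\<close>

text \<open>A minimiser of the Rayleigh quotient is an eigenvector: the nonnegative
  quadratic form \<open>(norm (A w))\<^sup>2 - m * (norm w)\<^sup>2\<close> vanishes there, so it has
  no first-order part in any direction.\<close>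

lemma rayleigh_minimiser_eigenvector:
  fixes A :: "real^'n^'m" and u :: "real^'n"
  assumes min: "\<And>w. m * (norm w)\<^sup>2 \<le> (norm (A *v w))\<^sup>2"
    and eq: "(norm (A *v u))\<^sup>2 = m * (norm u)\<^sup>2"
  shows "(transpose A ** A) *v u = m *\<^sub>R u"
proof -
  have "(A *v u) \<bullet> (A *v h) = m * (u \<bullet> h)" for h
  proof (rule ccontr)
    define c where "c = (A *v u) \<bullet> (A *v h) - m * (u \<bullet> h)"
    define d where "d = (norm (A *v h))\<^sup>2 - m * (norm h)\<^sup>2"
    assume "\<not> ?thesis"
    then have c: "c \<noteq> 0" by (simp add: c_def)
    have d: "d \<ge> 0" using min[of h] by (simp add: d_def)
    have quad: "2 * s * c + s\<^sup>2 * d \<ge> 0" for s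
    proof -
      have "(norm (A *v (u + s *\<^sub>R h)))\<^sup>2 - m * (norm (u + s *\<^sub>R h))\<^sup>2
        = ((norm (A *v u))\<^sup>2 - m * (norm u)\<^sup>2) + 2 * s * c + s\<^sup>2 * d"
        unfolding c_def d_def power2_norm_eq_inner
        by (simp add: matrix_vector_right_distrib matrix_vector_mult_scaleR
            inner_left_distrib inner_right_distrib inner_commute power2_eq_square algebra_simps)
      then show ?thesis using min[of "u + s *\<^sub>R h"] eq by simp
    qed
    have "2 * (- c / (d + 1)) * c + (- c / (d + 1))\<^sup>2 * d = - (c\<^sup>2 * (d + 2)) / (d + 1)\<^sup>2"
      using d by (simp add: divide_simps power2_eq_square) (simp add: algebra_simps)
    moreover have "\<dots> < 0" using c d by (simp add: divide_neg_pos)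
    ultimately show False using quad[of "- c / (d + 1)"] by linarith
  qed
  then have "((A *v u) v* A) \<bullet> h = (m *\<^sub>R u) \<bullet> h" for h
    by (simp add: dot_lmul_matrix)
  then have "(A *v u) v* A = m *\<^sub>R u"
    by (metis vector_eq_rdot)
  then show ?thesis
    by (simp flip: matrix_vector_mul_assoc)
qed

text \<open>The least element in the definition of \<open>sigma_min\<close> exists because the Rayleigh quotient
  attains its minimum on the compact unit sphere, and every eigenvalue is a value of that
  quotient.\<close>

lemma sigma_min_square_le:
  fixes A :: "real^'n^'m" and w :: "real^'n"
  shows "(sigma_min A)\<^sup>2 * (norm w)\<^sup>2 \<le> (norm (A *v w))\<^sup>2"
proof -
  let ?S = "sphere (0 :: real^'n) 1"
  have "?S \<noteq> {}" by simp
  moreover have "continuous_on ?S (\<lambda>u. (norm (A *v u))\<^sup>2)"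
    by (intro continuous_intros linear_continuous_on matrix_vector_mul_bounded_linear)
  ultimately obtain u where u: "u \<in> ?S"
    and inf: "\<And>w. w \<in> ?S \<Longrightarrow> (norm (A *v u))\<^sup>2 \<le> (norm (A *v w))\<^sup>2"
    using continuous_attains_inf[OF compact_sphere] by meson
  define m where "m = (norm (A *v u))\<^sup>2"
  have min: "m * (norm w)\<^sup>2 \<le> (norm (A *v w))\<^sup>2" for w
  proof (cases "w = 0")
    case False
    have "m \<le> (norm (A *v ((1 / norm w) *\<^sub>R w)))\<^sup>2"
      unfolding m_def by (rule inf) (use False in simp)
    also have "\<dots> = (norm (A *v w))\<^sup>2 / (norm w)\<^sup>2"
      by (simp add: matrix_vector_mult_scaleR power_divide)
    finally show ?thesis using False by (simp add: field_simps)
  qed simp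
  have "u \<noteq> 0" using u by auto
  then have m_eig: "m \<in> eigenvalues (transpose A ** A)"
    unfolding eigenvalues_def
    using rayleigh_minimiser_eigenvector[OF min, of u] u by (auto simp: m_def)
  have m_le: "m \<le> e" if e: "e \<in> eigenvalues (transpose A ** A)" for e
  proof -
    obtain z where z: "z \<noteq> 0" "(transpose A ** A) *v z = e *\<^sub>R z"
      using e unfolding eigenvalues_def by blast
    have "(norm (A *v z))\<^sup>2 = ((A *v z) v* A) \<bullet> z"
      by (simp add: dot_lmul_matrix power2_norm_eq_inner)
    also have "(A *v z) v* A = e *\<^sub>R z"
      using z(2) by (simp flip: matrix_vector_mul_assoc)
    finally have "m * (norm z)\<^sup>2 \<le> e * (norm z)\<^sup>2"
      using min[of z] by (simp add: power2_norm_eq_inner)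
    then show ?thesis using z(1) by simp
  qed
  have "sigma_min A = sqrt m"
    unfolding sigma_min_def
    by (rule Least_equality) (use m_eig m_le in \<open>auto simp: singular_values_def\<close>)
  then have "(sigma_min A)\<^sup>2 = m" by (simp add: m_def)
  then show ?thesis using min by simp
qed

lemma mu_aug_nonneg: "0 \<le> \<beta> \<Longrightarrow> 0 \<le> \<mu> \<Longrightarrow> 0 \<le> mu_aug A \<beta> \<mu>"
  by (simp add: mu_aug_def)

section \<open>The augmented Lagrangian\<close>

lemma grad_eqI:
  assumes "GDERIV f x :> D"
  shows "grad f x = D"
proof -
  have "f differentiable (at x)"
    using assms unfolding gderiv_def differentiable_def by blast
  then have "GDERIV f x :> grad f x" by (rule gderiv_grad)
  then have "(\<lambda>h. h \<bullet> grad f x) = (\<lambda>h. h \<bullet> D)"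
    using assms unfolding gderiv_def by (rule has_derivative_unique)
  then show ?thesis by (metis vector_eq_ldot)
qed

lemma gderiv_aug_lagr:
  fixes f :: "real^'n \<Rightarrow> real" and A :: "real^'n^'m"
  assumes "f differentiable (at x)"
  shows "GDERIV (\<lambda>y. aug_lagr f A b \<beta> y l) x :> grad f x + (\<beta> *\<^sub>R (A *v x - b) + l) v* A"
proof -
  have f: "(f has_derivative (\<lambda>h. h \<bullet> grad f x)) (at x)"
    using gderiv_grad[OF assms] by (simp add: gderiv_def)
  have A: "((\<lambda>y. A *v y) has_derivative (\<lambda>h. A *v h)) (at x)"
    by (rule bounded_linear_imp_has_derivative matrix_vector_mul_bounded_linear)+
  have adj: "h \<bullet> (w v* A) = w \<bullet> (A *v h)" for h w
    by (metis dot_lmul_matrix inner_commute)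
  show ?thesis
    unfolding gderiv_def aug_lagr_def aug_obj_def power2_norm_eq_inner
    by (rule has_derivative_eq_rhs, (rule derivative_intros f A)+)
      (simp add: fun_eq_iff inner_right_distrib adj,
       simp add: inner_left_distrib inner_commute[of _ "A *v x - b"])
qed

lemma grad_aug_lagr:
  fixes f :: "real^'n \<Rightarrow> real" and A :: "real^'n^'m"
  assumes "f differentiable (at x)"
  shows "grad (\<lambda>y. aug_lagr f A b \<beta> y l) x = grad f x + (\<beta> *\<^sub>R (A *v x - b) + l) v* A"
  by (rule grad_eqI gderiv_aug_lagr assms)+

lemma grad_aug_lagr_change_multiplier:
  fixes f :: "real^'n \<Rightarrow> real" and A :: "real^'n^'m"
  assumes "f differentiable (at x)"
  shows "grad (\<lambda>y. aug_lagr f A b \<beta> y k) x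
    = grad (\<lambda>y. aug_lagr f A b \<beta> y l) x - (l - k) v* A"
proof -
  have "\<beta> *\<^sub>R (A *v x - b) + k = (\<beta> *\<^sub>R (A *v x - b) + l) - (l - k)" by simp
  then have "(\<beta> *\<^sub>R (A *v x - b) + k) v* A
      = (\<beta> *\<^sub>R (A *v x - b) + l) v* A - (l - k) v* A"
    by (simp only: vector_matrix_mult_diff_distrib)
  then show ?thesis by (simp only: grad_aug_lagr[OF assms] add_diff_eq)
qed

text \<open>The penalty is quadratic, so its second-order remainder is exactly
  \<open>\<beta> / 2 * (norm (A (y - x)))\<^sup>2\<close>; this raises the modulus from \<open>\<mu>\<close> to \<open>mu_aug A \<beta> \<mu>\<close>.\<close>

lemma aug_lagr_strong_convexity:
  fixes f :: "real^'n \<Rightarrow> real" and A :: "real^'n^'m"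
  assumes S: "class_S11 \<mu> L f" and "0 \<le> \<beta>"
  shows "aug_lagr f A b \<beta> x l + grad (\<lambda>z. aug_lagr f A b \<beta> z l) x \<bullet> (y - x)
      + mu_aug A \<beta> \<mu> / 2 * (norm (y - x))\<^sup>2 \<le> aug_lagr f A b \<beta> y l"
proof -
  define d where "d = y - x"
  have y: "y = x + d" by (simp add: d_def)
  have f: "f x + grad f x \<bullet> d + \<mu> / 2 * (norm d)\<^sup>2 \<le> f y"
    using S unfolding class_S11_def d_def by blast
  have "f differentiable (at x)" using S by (simp add: class_S11_def)
  then have "grad (\<lambda>z. aug_lagr f A b \<beta> z l) x \<bullet> d
      = grad f x \<bullet> d + \<beta> * ((A *v x - b) \<bullet> (A *v d)) + l \<bullet> (A *v d)"
    by (simp add: grad_aug_lagr inner_left_distrib dot_lmul_matrix)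
  moreover have "\<beta> / 2 * (norm (A *v y - b))\<^sup>2 = \<beta> / 2 * (norm (A *v x - b))\<^sup>2
      + \<beta> * ((A *v x - b) \<bullet> (A *v d)) + \<beta> / 2 * (norm (A *v d))\<^sup>2"
  proof -
    have split: "A *v y - b = (A *v x - b) + A *v d"
      by (simp add: y matrix_vector_right_distrib)
    have "(norm (A *v y - b))\<^sup>2
        = (norm (A *v x - b))\<^sup>2 + 2 * ((A *v x - b) \<bullet> (A *v d)) + (norm (A *v d))\<^sup>2"
      unfolding split using dot_norm[of "A *v x - b" "A *v d"] by (simp)
    then show ?thesis by (simp add: distrib_left)
  qed
  moreover have "l \<bullet> (A *v y - b) = l \<bullet> (A *v x - b) + l \<bullet> (A *v d)"
    by (simp add: y matrix_vector_right_distrib inner_right_distrib inner_diff_right)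
  moreover have "\<beta> * ((sigma_min A)\<^sup>2 * (norm d)\<^sup>2) \<le> \<beta> * (norm (A *v d))\<^sup>2"
    using sigma_min_square_le \<open>0 \<le> \<beta>\<close> by (rule mult_left_mono)
  moreover have "mu_aug A \<beta> \<mu> / 2 * (norm d)\<^sup>2
      = \<mu> / 2 * (norm d)\<^sup>2 + \<beta> * ((sigma_min A)\<^sup>2 * (norm d)\<^sup>2) / 2"
    by (simp add: mu_aug_def field_simps)
  ultimately show ?thesis
    using f unfolding aug_lagr_def[of _ _ _ _ x] aug_lagr_def[of _ _ _ _ y] aug_obj_def d_def[symmetric]
    by linarith
qed

lemma saddle_point_feasible:
  assumes "saddle_point (lagr f A b) xs ls"
  shows "A *v xs = b"
proof -
  have "lagr f A b xs (ls + (A *v xs - b)) \<le> lagr f A b xs ls"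
    using assms by (simp add: saddle_point_def)
  then have "(A *v xs - b) \<bullet> (A *v xs - b) \<le> 0"
    by (simp add: lagr_def inner_left_distrib)
  then have "A *v xs - b = 0"
    by (metis inner_eq_zero_iff inner_ge_zero order_antisym)
  then show ?thesis by simp
qed

section \<open>Dissipation of the energy\<close>

text \<open>This is the derivative of the energy at a fixed time, with \<open>G\<close> the gradient of the
  augmented Lagrangian at the multiplier \<open>l\<close>; its
  gradient at \<open>ls\<close> is \<open>G - (l - ls) v* A\<close>. The vectors \<open>\<gamma> dv\<close> and
  \<open>\<theta> dl\<close> enter only through the right-hand sides of the flow. The quadratic terms
  combine through
  \<open>2 (x - v) \<bullet> (v - xs) = (norm (x - xs))\<^sup>2 - (norm (x - v))\<^sup>2 - (norm (v - xs))\<^sup>2\<close>.\<close>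

lemma flow_dissipation:
  fixes A :: "real^'n^'m" and x v xs G dv :: "real^'n" and l ls dl :: "real^'m"
  assumes feas: "A *v xs = b"
    and dl: "\<theta> *\<^sub>R dl = A *v v - b"
    and dv: "\<gamma> *\<^sub>R dv = m *\<^sub>R (x - v) - G"
    and conv: "F x + (G - (l - ls) v* A) \<bullet> (xs - x) + m / 2 * (norm (xs - x))\<^sup>2 \<le> F xs"
  shows "(G - (l - ls) v* A) \<bullet> (v - x)
      + ((m - \<gamma>) / 2 * (norm (v - xs))\<^sup>2 + \<gamma> * ((v - xs) \<bullet> dv))
      + (- \<theta> / 2 * (norm (l - ls))\<^sup>2 + \<theta> * ((l - ls) \<bullet> dl))
    \<le> - (F x - F xs + \<gamma> / 2 * (norm (v - xs))\<^sup>2 + \<theta> / 2 * (norm (l - ls))\<^sup>2)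
      - m / 2 * (norm (v - x))\<^sup>2"
proof -
  have "\<gamma> * ((v - xs) \<bullet> dv) = (v - xs) \<bullet> (\<gamma> *\<^sub>R dv)" by simp
  also have "\<dots> = m * ((v - xs) \<bullet> (x - v)) - G \<bullet> (v - xs)"
    unfolding dv by (simp add: inner_diff_right[of _ _ G] inner_commute)
  finally have 1: "\<gamma> * ((v - xs) \<bullet> dv) = m * ((v - xs) \<bullet> (x - v)) - G \<bullet> (v - xs)" .
  have "\<theta> * ((l - ls) \<bullet> dl) = (l - ls) \<bullet> (\<theta> *\<^sub>R dl)" by simp
  also have "\<dots> = (l - ls) \<bullet> (A *v (v - xs))"
    unfolding dl by (simp add: matrix_vector_mult_diff_distrib feas)
  finally have 2: "\<theta> * ((l - ls) \<bullet> dl) = ((l - ls) v* A) \<bullet> (v - xs)"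
    by (simp add: dot_lmul_matrix)
  have 3: "(G - (l - ls) v* A) \<bullet> (v - x)
      = (G - (l - ls) v* A) \<bullet> (xs - x) + G \<bullet> (v - xs) - ((l - ls) v* A) \<bullet> (v - xs)"
    by (simp add: inner_diff_left inner_diff_right)
  have "(v - xs) \<bullet> (x - v) = ((norm (xs - x))\<^sup>2 - (norm (v - x))\<^sup>2 - (norm (v - xs))\<^sup>2) / 2"
    by (simp add: power2_norm_eq_inner inner_diff_left inner_diff_right inner_commute)
  then have 4: "m * ((v - xs) \<bullet> (x - v)) = m / 2 * (norm (xs - x))\<^sup>2
      - m / 2 * (norm (v - x))\<^sup>2 - m / 2 * (norm (v - xs))\<^sup>2"
    by (simp add: right_diff_distrib diff_divide_distrib)
  have 5: "(m - \<gamma>) / 2 * (norm (v - xs))\<^sup>2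
      = m / 2 * (norm (v - xs))\<^sup>2 - \<gamma> / 2 * (norm (v - xs))\<^sup>2"
    by (simp add: algebra_simps diff_divide_distrib)
  show ?thesis using conv unfolding 1 2 3 4 5 by simp
qed

section \<open>Integrating differential relations on the half-line\<close>

text \<open>The function \<open>exp t * E t + \<integral>\<^sub>0\<^sup>t exp s * w s\<close> is nonincreasing.\<close>

lemma gronwall_dissipation:
  fixes E w :: "real \<Rightarrow> real"
  assumes E: "\<And>t. t \<ge> 0 \<Longrightarrow> (E has_real_derivative D t) (at t within {0..})"
    and D: "\<And>t. t \<ge> 0 \<Longrightarrow> D t \<le> - E t - w t"
    and w: "continuous_on {0..} w" and "t \<ge> 0"
  shows "E t + integral {0..t} (\<lambda>s. exp (s - t) * w s) \<le> exp (- t) * E 0"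
proof (cases "t = 0")
  case False
  define h where "h r = exp r * E r + integral {0..r} (\<lambda>s. exp s * w s)" for r
  have cont: "continuous_on {0..t} (\<lambda>s. exp s * w s)"
    by (intro continuous_intros continuous_on_subset[OF w]) auto
  have h: "(h has_real_derivative exp r * (E r + D r + w r)) (at r within {0..t})"
    if r: "r \<in> {0..t}" for r
  proof -
    have "(E has_real_derivative D r) (at r within {0..t})"
      by (rule has_field_derivative_subset[OF E]) (use r in auto)
    moreover have "((\<lambda>q. integral {0..q} (\<lambda>s. exp s * w s)) has_real_derivative exp r * w r)
        (at r within {0..t})"
      using cont r by (rule integral_has_real_derivative)
    ultimately show ?thesis unfolding h_def
      by (auto intro!: derivative_eq_intros simp: algebra_simps)
  qed
  have "\<exists>r\<in>{0<..<t}. h t - h 0 = (t - 0) * (exp r * (E r + D r + w r))"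
  proof -
    have "\<exists>r\<in>{0<..<t}. h t - h 0 = (\<lambda>y. exp r * (E r + D r + w r) * y) (t - 0)"
      by (rule mvt_simple)
        (use False \<open>t \<ge> 0\<close> h in \<open>auto simp: has_field_derivative_def\<close>)
    then show ?thesis by (simp add: mult.commute)
  qed
  then obtain r where r: "0 < r" "r < t"
    and hr: "h t - h 0 = t * (exp r * (E r + D r + w r))" by auto
  have "t * (exp r * (E r + D r + w r)) \<le> 0"
    using D[of r] r by (intro mult_nonneg_nonpos) auto
  then have "h t \<le> E 0" using hr by (simp add: h_def)
  then have "exp (- t) * h t \<le> exp (- t) * E 0" by simp
  moreover have "exp (- t) * h t = E t + integral {0..t} (\<lambda>s. exp (s - t) * w s)"
  proof -
    have "integral {0..t} (\<lambda>s. exp (s - t) * w s)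
        = integral {0..t} (\<lambda>s. exp (- t) * (exp s * w s))"
      by (simp add: exp_diff exp_minus field_simps)
    also have "\<dots> = exp (- t) * integral {0..t} (\<lambda>s. exp s * w s)" by simp
    finally show ?thesis by (simp add: h_def distrib_left flip: mult.assoc exp_add)
  qed
  ultimately show ?thesis by simp
qed simp

lemma zero_derivative_half_line_constant:
  fixes h :: "real \<Rightarrow> 'a::real_normed_vector"
  assumes "\<And>t. t \<ge> 0 \<Longrightarrow> (h has_vector_derivative 0) (at t within {0..})" and "t \<ge> 0"
  shows "h t = h 0"
proof -
  obtain c where "\<And>s. s \<in> {0..} \<Longrightarrow> h s = c"
    by (rule has_vector_derivative_zero_constant[of "{0..}" h]) (use assms in auto)
  then show ?thesis using \<open>t \<ge> 0\<close> by simp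
qed

text \<open>The quantity \<open>exp t (y t - c)\<close> is constant. Writing the solution as a convex combination
  of \<open>c\<close> and \<open>y 0\<close> makes the sign of \<open>\<gamma>\<close> evident.\<close>

lemma relaxation_solution:
  fixes y :: "real \<Rightarrow> real"
  assumes "\<And>t. t \<ge> 0 \<Longrightarrow> (y has_real_derivative c - y t) (at t within {0..})" and "t \<ge> 0"
  shows "y t = c * (1 - exp (- t)) + exp (- t) * y 0"
proof -
  have "((\<lambda>s. exp s * (y s - c)) has_vector_derivative 0) (at s within {0..})" if "s \<ge> 0" for s
    unfolding has_real_derivative_iff_has_vector_derivative[symmetric]
    by (auto intro!: derivative_eq_intros assms that simp: algebra_simps)
  from zero_derivative_half_line_constant[OF this \<open>t \<ge> 0\<close>]
  have "exp t * (y t - c) = y 0 - c" by simp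
  then have "y t - c = exp (- t) * (y 0 - c)" by (simp add: exp_minus field_simps)
  then show ?thesis by (simp add: algebra_simps)
qed

section \<open>Exponential decay along the primal-dual flow\<close>


theorem lemma2p1:
  fixes A :: "real^'n^'m" and b :: "real^'m"
    and f :: "real^'n \<Rightarrow> real"
    and \<beta> \<mu> L \<theta>0 \<gamma>0 R0 :: real
    and xs :: "real^'n" and ls :: "real^'m"
    and \<theta> \<gamma> E :: "real \<Rightarrow> real"
    and lam lam' :: "real \<Rightarrow> real^'m"
    and x x' v v' :: "real \<Rightarrow> real^'n"
    and lam0 :: "real^'m" and x0 v0 :: "real^'n"
  assumes "\<beta> \<ge> 0" and "0 \<le> \<mu>" and "\<mu> \<le> L"
    and "class_S11 \<mu> L f"
    and "saddle_point (lagr f A b) xs ls"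
    and "\<theta>0 > 0" and "\<gamma>0 > 0"
    and "\<And>t. t \<ge> 0 \<Longrightarrow> (\<theta> has_real_derivative - \<theta> t) (at t within {0..})"
    and "\<And>t. t \<ge> 0 \<Longrightarrow>
           (\<gamma> has_real_derivative mu_aug A \<beta> \<mu> - \<gamma> t) (at t within {0..})"
    and "\<theta> 0 = \<theta>0" and "\<gamma> 0 = \<gamma>0"
    and "\<And>t. t \<ge> 0 \<Longrightarrow> (lam has_vector_derivative lam' t) (at t within {0..})"
    and "\<And>t. t \<ge> 0 \<Longrightarrow> (x has_vector_derivative x' t) (at t within {0..})"
    and "\<And>t. t \<ge> 0 \<Longrightarrow> (v has_vector_derivative v' t) (at t within {0..})"
    and "\<And>t. t \<ge> 0 \<Longrightarrow> \<theta> t *\<^sub>R lam' t = A *v v t - b"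
    and "\<And>t. t \<ge> 0 \<Longrightarrow> x' t = v t - x t"
    and "\<And>t. t \<ge> 0 \<Longrightarrow>
           \<gamma> t *\<^sub>R v' t =
             mu_aug A \<beta> \<mu> *\<^sub>R (x t - v t) - grad (\<lambda>y. aug_lagr f A b \<beta> y (lam t)) (x t)"
    and "lam 0 = lam0" and "x 0 = x0" and "v 0 = v0"
    and "\<And>t. t \<ge> 0 \<Longrightarrow>
           E t = aug_lagr f A b \<beta> (x t) ls - aug_lagr f A b \<beta> xs (lam t)
                 + \<gamma> t / 2 * (norm (v t - xs))\<^sup>2 + \<theta> t / 2 * (norm (lam t - ls))\<^sup>2"
    and "R0 = sqrt (2 * \<theta>0 * E 0) + \<theta>0 * norm (lam0 - ls) + norm (A *v x0 - b)"
  shows "(\<forall>t\<ge>0. \<exists>D. (E has_real_derivative D) (at t within {0..}) \<and>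
                 D \<le> - E t - mu_aug A \<beta> \<mu> / 2 * (norm (x' t))\<^sup>2)
       \<and> (\<forall>t\<ge>0. (\<lambda>s. exp (s - t) * (norm (x' s))\<^sup>2) integrable_on {0..t} \<and>
                 E t + mu_aug A \<beta> \<mu> / 2 * integral {0..t} (\<lambda>s. exp (s - t) * (norm (x' s))\<^sup>2)
                   \<le> exp (- t) * E 0)
       \<and> (\<forall>t\<ge>0. norm (A *v x t - b) \<le> exp (- t) * R0)
       \<and> (\<forall>t\<ge>0. \<bar>f (x t) - f xs\<bar> \<le> exp (- t) * (E 0 + R0 * norm ls))"
proof -
  note S11 = assms(4) and saddle = assms(5)
  note d\<theta> = assms(8) and d\<gamma> = assms(9) and dlam = assms(12) and dx = assms(13)
    and dv = assms(14) and flow_lam = assms(15) and flow_x = assms(16) and flow_v = assms(17)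
    and E_def = assms(21)
  define m where "m = mu_aug A \<beta> \<mu>"
  define F where "F = (\<lambda>y. aug_lagr f A b \<beta> y ls)"
  define G where "G t = grad (\<lambda>y. aug_lagr f A b \<beta> y (lam t)) (x t)" for t
  define H where "H t = G t - (lam t - ls) v* A" for t
  have m: "m \<ge> 0" using mu_aug_nonneg assms(1,2) by (simp add: m_def)
  have feas: "A *v xs = b" using saddle by (rule saddle_point_feasible)
  have diff: "f differentiable (at y)" for y using S11 by (simp add: class_S11_def)
  have H: "grad F (x t) = H t" for t
    unfolding F_def H_def G_def by (rule grad_aug_lagr_change_multiplier[OF diff])
  have F_xs: "F xs = f xs" by (simp add: F_def aug_lagr_def aug_obj_def feas)
  have E: "E t = F (x t) - F xs + \<gamma> t / 2 * (norm (v t - xs))\<^sup>2 + \<theta> t / 2 * (norm (lam t - ls))\<^sup>2"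
    if "t \<ge> 0" for t
    using E_def[OF that] by (simp add: F_def aug_lagr_def feas)

  define D where "D t = H t \<bullet> (v t - x t)
      + ((m - \<gamma> t) / 2 * (norm (v t - xs))\<^sup>2 + \<gamma> t * ((v t - xs) \<bullet> v' t))
      + (- \<theta> t / 2 * (norm (lam t - ls))\<^sup>2 + \<theta> t * ((lam t - ls) \<bullet> lam' t))" for t
  have D: "(E has_real_derivative D t) (at t within {0..})" if t: "t \<ge> 0" for t
  proof -
    have "GDERIV F (x t) :> H t"
      using gderiv_aug_lagr[OF diff] H unfolding F_def by (metis grad_eqI)
    then have "(F has_derivative (\<lambda>h. h \<bullet> H t)) (at (x t))" by (simp add: gderiv_def)
    then have "((\<lambda>s. F (x s)) has_derivative (\<lambda>h. (h *\<^sub>R x' t) \<bullet> H t)) (at t within {0..})"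
      using dx[OF t] unfolding has_vector_derivative_def
      by (rule has_derivative_compose[rotated])
    then have dF: "((\<lambda>s. F (x s)) has_real_derivative H t \<bullet> (v t - x t)) (at t within {0..})"
      unfolding has_field_derivative_def
      by (rule has_derivative_eq_rhs) (simp add: fun_eq_iff flow_x[OF t] inner_commute)
    have sq: "((\<lambda>s. (norm (y s - c))\<^sup>2) has_real_derivative 2 * ((y t - c) \<bullet> y')) (at t within {0..})"
      if "(y has_vector_derivative y') (at t within {0..})"
      for y :: "real \<Rightarrow> 'z::real_inner" and c y'
      using that unfolding power2_norm_eq_inner has_field_derivative_def has_vector_derivative_def
      by (auto intro!: derivative_eq_intros simp: fun_eq_iff inner_commute algebra_simps)
    have "((\<lambda>s. F (x s) - F xs + \<gamma> s / 2 * (norm (v s - xs))\<^sup>2 + \<theta> s / 2 * (norm (lam s - ls))\<^sup>2)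
        has_real_derivative D t) (at t within {0..})"
      unfolding D_def
      by (rule DERIV_cong, (rule dF sq dv[OF t] dlam[OF t] d\<gamma>[OF t] d\<theta>[OF t]
            DERIV_add DERIV_diff DERIV_mult DERIV_cdivide DERIV_const)+) (simp add: m_def)
    then show ?thesis
      by (rule has_field_derivative_transform_within[where d = 1]) (use t E in auto)
  qed
  have D_le: "D t \<le> - E t - m / 2 * (norm (x' t))\<^sup>2" if t: "t \<ge> 0" for t
    unfolding D_def H_def E[OF t] flow_x[OF t]
  proof (rule flow_dissipation[OF feas flow_lam[OF t]])
    show "\<gamma> t *\<^sub>R v' t = m *\<^sub>R (x t - v t) - G t"
      using flow_v[OF t] by (simp add: m_def G_def)
    show "F (x t) + (G t - (lam t - ls) v* A) \<bullet> (xs - x t) + m / 2 * (norm (xs - x t))\<^sup>2 \<le> F xs"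
      using aug_lagr_strong_convexity[OF S11 assms(1), of A b "x t" ls xs] H[of t]
      by (simp add: F_def m_def H_def)
  qed

  have "continuous_on {0..} x" "continuous_on {0..} v"
    unfolding continuous_on_eq_continuous_within
    by (auto intro: has_vector_derivative_continuous dx dv)
  then have "continuous_on {0..} (\<lambda>t. (norm (v t - x t))\<^sup>2)" by (intro continuous_intros)
  then have cont: "continuous_on {0..} (\<lambda>t. (norm (x' t))\<^sup>2)"
    by (rule continuous_on_eq) (simp add: flow_x)
  have integrable: "(\<lambda>s. exp (s - t) * (norm (x' s))\<^sup>2) integrable_on {0..t}" for t
    by (intro integrable_continuous_interval continuous_intros continuous_on_subset[OF cont]) auto
  have decay: "E t + m / 2 * integral {0..t} (\<lambda>s. exp (s - t) * (norm (x' s))\<^sup>2) \<le> exp (- t) * E 0"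
    if t: "t \<ge> 0" for t
  proof -
    have "continuous_on {0..} (\<lambda>s. m / 2 * (norm (x' s))\<^sup>2)"
      by (intro continuous_intros cont)
    from gronwall_dissipation[OF D D_le this t]
    have "E t + integral {0..t} (\<lambda>s. m / 2 * (exp (s - t) * (norm (x' s))\<^sup>2)) \<le> exp (- t) * E 0"
      by (simp only: mult.left_commute[of "m / 2"])
    then show ?thesis by (simp only: integral_mult_right)
  qed
  have E_le: "E t \<le> exp (- t) * E 0" if t: "t \<ge> 0" for t
  proof -
    have "0 \<le> m / 2 * integral {0..t} (\<lambda>s. exp (s - t) * (norm (x' s))\<^sup>2)"
      using m by (intro mult_nonneg_nonneg integral_nonneg integrable) auto
    then show ?thesis using decay[OF t] by linarith
  qed

  have \<theta>: "\<theta> t = exp (- t) * \<theta>0" if "t \<ge> 0" for t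
    using relaxation_solution[of \<theta> 0 t] d\<theta> that assms(10) by simp
  have \<gamma>: "\<gamma> t \<ge> 0" if t: "t \<ge> 0" for t
  proof -
    have "\<gamma> t = m * (1 - exp (- t)) + exp (- t) * \<gamma>0"
      using relaxation_solution[of \<gamma> m t] d\<gamma> t assms(11) by (simp add: m_def)
    then show ?thesis using m t assms(7) by simp
  qed
  have gap: "0 \<le> f (x t) + ls \<bullet> (A *v x t - b) - f xs"
    "f (x t) + ls \<bullet> (A *v x t - b) - f xs \<le> F (x t) - F xs" for t
  proof -
    have "lagr f A b xs ls \<le> lagr f A b (x t) ls"
      using saddle by (simp add: saddle_point_def)
    then show "0 \<le> f (x t) + ls \<bullet> (A *v x t - b) - f xs" by (simp add: lagr_def feas)
    show "f (x t) + ls \<bullet> (A *v x t - b) - f xs \<le> F (x t) - F xs"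
      using assms(1) unfolding F_xs by (simp add: F_def aug_lagr_def aug_obj_def)
  qed
  have gap_le: "F (x t) - F xs \<le> E t" and lam_le: "\<theta> t / 2 * (norm (lam t - ls))\<^sup>2 \<le> E t"
    if t: "t \<ge> 0" for t
  proof -
    have "0 \<le> \<gamma> t / 2 * (norm (v t - xs))\<^sup>2" using \<gamma>[OF t] by simp
    moreover have "0 \<le> \<theta> t / 2 * (norm (lam t - ls))\<^sup>2" using \<theta>[OF t] assms(6) by simp
    moreover have "0 \<le> F (x t) - F xs" using gap[of t] by linarith
    ultimately show "F (x t) - F xs \<le> E t" "\<theta> t / 2 * (norm (lam t - ls))\<^sup>2 \<le> E t"
      using E[OF t] by linarith+
  qed

  have infeasibility: "norm (A *v x t - b) \<le> exp (- t) * R0" if t: "t \<ge> 0" for t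
  proof -
    \<comment> \<open>The factors \<open>exp (- t)\<close> of \<open>E\<close> and \<open>\<theta>\<close> cancel, so the bound on \<open>lam\<close> is uniform in time.\<close>
    have "exp (- t) * (\<theta>0 / 2 * (norm (lam t - ls))\<^sup>2) = \<theta> t / 2 * (norm (lam t - ls))\<^sup>2"
      by (simp add: \<theta>[OF t])
    also have "\<dots> \<le> exp (- t) * E 0" using lam_le[OF t] E_le[OF t] by linarith
    finally have "\<theta>0 / 2 * (norm (lam t - ls))\<^sup>2 \<le> E 0"
      by (simp only: mult_le_cancel_left_pos exp_gt_zero)
    then have "2 * \<theta>0 * (\<theta>0 / 2 * (norm (lam t - ls))\<^sup>2) \<le> 2 * \<theta>0 * E 0"
      by (rule mult_left_mono) (use assms(6) in simp)
    then have "(\<theta>0 * norm (lam t - ls))\<^sup>2 \<le> 2 * \<theta>0 * E 0"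
      by (simp add: power2_eq_square mult_ac)
    then have lam: "\<theta>0 * norm (lam t - ls) \<le> sqrt (2 * \<theta>0 * E 0)" by (rule real_le_rsqrt)
    \<comment> \<open>Since \<open>v = x + x'\<close>, the multiplier equation times \<open>exp t\<close> is a total derivative:
      \<open>\<theta>0 lam' = exp t (A v - b) = (exp t (A x - b))'\<close>.\<close>
    have "((\<lambda>s. exp s *\<^sub>R (A *v x s - b) - \<theta>0 *\<^sub>R lam s) has_vector_derivative 0) (at s within {0..})"
      if s: "s \<ge> 0" for s
    proof -
      have dA: "((\<lambda>s. A *v x s) has_vector_derivative A *v x' s) (at s within {0..})"
        using matrix_vector_mul_bounded_linear dx[OF s]
        by (rule bounded_linear.has_vector_derivative)
      have de: "(exp has_real_derivative exp s) (at s within {0..})"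
        by (auto intro!: derivative_eq_intros)
      have "exp s *\<^sub>R (A *v v s - b) = (exp s * \<theta> s) *\<^sub>R lam' s"
        by (simp flip: flow_lam[OF s])
      also have "exp s * \<theta> s = \<theta>0" using \<theta>[OF s] by (simp flip: mult.assoc exp_add)
      finally have bal: "exp s *\<^sub>R (A *v v s - b) = \<theta>0 *\<^sub>R lam' s" .
      have "exp s *\<^sub>R (A *v x' s) + exp s *\<^sub>R (A *v x s - b) = exp s *\<^sub>R (A *v v s - b)"
        by (simp add: flow_x[OF s] matrix_vector_mult_diff_distrib flip: scaleR_right_distrib)
      then have zero: "exp s *\<^sub>R (A *v x' s - 0) + exp s *\<^sub>R (A *v x s - b) - \<theta>0 *\<^sub>R lam' s = 0"
        using bal by simp
      have "((\<lambda>s. exp s *\<^sub>R (A *v x s - b) - \<theta>0 *\<^sub>R lam s) has_vector_derivative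
          exp s *\<^sub>R (A *v x' s - 0) + exp s *\<^sub>R (A *v x s - b) - \<theta>0 *\<^sub>R lam' s) (at s within {0..})"
        by (intro has_vector_derivative_diff has_vector_derivative_scaleR de dA
            has_vector_derivative_const
            bounded_linear.has_vector_derivative[OF bounded_linear_scaleR_right dlam[OF s]])
      then show ?thesis unfolding zero .
    qed
    from zero_derivative_half_line_constant[OF this t]
    have cons: "exp t *\<^sub>R (A *v x t - b) = (A *v x0 - b) + \<theta>0 *\<^sub>R (lam t - ls) - \<theta>0 *\<^sub>R (lam0 - ls)"
      using assms(18,19) by (simp add: algebra_simps)
    have "norm (exp t *\<^sub>R (A *v x t - b))
        \<le> norm (A *v x0 - b) + norm (\<theta>0 *\<^sub>R (lam t - ls)) + norm (\<theta>0 *\<^sub>R (lam0 - ls))"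
      unfolding cons using norm_triangle_ineq4[of "A *v x0 - b + \<theta>0 *\<^sub>R (lam t - ls)" "\<theta>0 *\<^sub>R (lam0 - ls)"]
        norm_triangle_ineq[of "A *v x0 - b" "\<theta>0 *\<^sub>R (lam t - ls)"] by linarith
    then have "exp t * norm (A *v x t - b) \<le> R0"
      using lam assms(6,22) by simp
    then have "exp (- t) * (exp t * norm (A *v x t - b)) \<le> exp (- t) * R0" by simp
    then show ?thesis by (simp flip: mult.assoc exp_add)
  qed

  have objective: "\<bar>f (x t) - f xs\<bar> \<le> exp (- t) * (E 0 + R0 * norm ls)" if t: "t \<ge> 0" for t
  proof -
    have "\<bar>ls \<bullet> (A *v x t - b)\<bar> \<le> norm ls * norm (A *v x t - b)"
      by (rule Cauchy_Schwarz_ineq2)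
    also have "\<dots> \<le> norm ls * (exp (- t) * R0)"
      using infeasibility[OF t] by (intro mult_left_mono) auto
    finally have "\<bar>ls \<bullet> (A *v x t - b)\<bar> \<le> exp (- t) * (R0 * norm ls)"
      by (simp add: mult_ac)
    then show ?thesis
      using gap[of t] gap_le[OF t] E_le[OF t] by (simp add: distrib_left)
  qed

  show ?thesis
    using D D_le integrable decay infeasibility objective unfolding m_def by blast
qed

end
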